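(* Let $E,F$ be Banach spaces over the same field $\mathbb K\in\{\mathbb R,\mathbb C\}$, let $U\subseteq E$ be open and let $f,g\colon U\to F$ be differentiable at $x\in U$. If $\lambda,\mu\in\mathbb K$, then $\lambda f+\mu g$ is differentiable at $x$ and $D(\lambda f+\mu g)(x)=\lambda Df(x)+\mu Dg(x)$.
   Context: $\mathcal L(E,F)$ denotes the space of bounded linear operators from $E$ to $F$ with the operator norm. Differentiability (in the sense of Carathéodory): $f\colon U\to F$ is differentiable at $x\in U$ if there exists a map $\Phi_x\colon U\to\mathcal L(E,F)$, continuous at $x$, such that $f(y)=f(x)+\Phi_x(y)(y-x)$ for all $y\in U$. Such a $\Phi_x$ is called a slope function of $f$ at $x$, and $Df(x):=\Phi_x(x)$ is the derivative of $f$ at $x$ (it does not depend on the choice of slope function). *)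

theory Defs
  imports "HOL-Analysis.Analysis"
begin

text \<open>The scalar fields \<open>\<real>\<close> and \<open>\<complex>\<close>, treated uniformly. Since the norm of a
  \<open>real_normed_field\<close> is multiplicative and satisfies \<open>norm (r *\<^sub>R 1) = \<bar>r\<bar>\<close>, every
  instance is isometrically isomorphic to \<open>real\<close> or to \<open>complex\<close>.\<close>

class real_or_complex = real_normed_field +
  assumes real_or_complex:
    "(\<forall>z. \<exists>r. z = r *\<^sub>R 1) \<or> (\<exists>i. i * i = - 1 \<and> (\<forall>z. \<exists>r s. z = r *\<^sub>R 1 + s *\<^sub>R i))"

instance real :: real_or_complex
  by standard simp

instance complex :: real_or_complex
proof
  have "z = Re z *\<^sub>R 1 + Im z *\<^sub>R \<i>" for z
    by (simp add: complex_eq_iff)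
  then have "\<i> * \<i> = - 1 \<and> (\<forall>z. \<exists>r s. z = r *\<^sub>R 1 + s *\<^sub>R \<i>)"
    by auto
  then show "(\<forall>z::complex. \<exists>r. z = r *\<^sub>R 1) \<or>
      (\<exists>i::complex. i * i = - 1 \<and> (\<forall>z. \<exists>r s. z = r *\<^sub>R 1 + s *\<^sub>R i))"
    by blast
qed

text \<open>A Banach space over \<open>'k\<close>. The norm and completeness come from the class \<open>banach\<close>, whose
  real scalar multiplication is the restriction of \<open>scale\<close> along \<open>of_real\<close>.\<close>

locale banach_space_over = vector_space scale
  for scale :: "'k::real_or_complex \<Rightarrow> 'e::banach \<Rightarrow> 'e" +
  assumes norm_scale: "norm (scale c v) = norm c * norm v"
    and scale_of_real: "scale (of_real r) v = r *\<^sub>R v"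

lemma banach_space_over_scaleR: "banach_space_over (scaleR :: real \<Rightarrow> 'e::banach \<Rightarrow> 'e)"
  by unfold_locales (simp_all add: algebra_simps)

lemma banach_space_over_times:
  "banach_space_over ((*) :: 'k::{real_or_complex,banach} \<Rightarrow> 'k \<Rightarrow> 'k)"
  by unfold_locales (simp_all add: algebra_simps norm_mult scaleR_conv_of_real)

text \<open>The space \<open>\<L>(E,F)\<close>, as the set of those bounded real-linear maps that are linear over
  \<open>'k\<close>; the norm of \<open>'e \<Rightarrow>\<^sub>L 'f\<close> is the operator norm.\<close>

definition bounded_operators ::
  "('k::real_or_complex \<Rightarrow> 'e::banach \<Rightarrow> 'e) \<Rightarrow> ('k \<Rightarrow> 'f::banach \<Rightarrow> 'f) \<Rightarrow> ('e \<Rightarrow>\<^sub>L 'f) set"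
  where "bounded_operators sE sF = {A. Vector_Spaces.linear sE sF (blinfun_apply A)}"

text \<open>The scalar multiplication of \<open>\<L>(E,F)\<close>, induced by that of \<open>F\<close>.\<close>

definition scale_operator ::
  "('k::real_or_complex \<Rightarrow> 'f::banach \<Rightarrow> 'f) \<Rightarrow> 'k \<Rightarrow> ('e::banach \<Rightarrow>\<^sub>L 'f) \<Rightarrow> ('e \<Rightarrow>\<^sub>L 'f)"
  where "scale_operator sF c A = Blinfun (\<lambda>h. sF c (blinfun_apply A h))"

lemma (in banach_space_over) bounded_linear_scale: "bounded_linear (scale c)"
proof (rule bounded_linear_intro[where K = "norm c"])
  show "scale c (r *\<^sub>R v) = r *\<^sub>R scale c v" for r v
    by (metis scale_left_commute scale_of_real)
qed (simp_all add: norm_scale scale_right_distrib)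

lemma (in banach_space_over) scale_operator_apply:
  "blinfun_apply (scale_operator scale c A) h = scale c (blinfun_apply A h)"
  unfolding scale_operator_def
  by (subst bounded_linear_Blinfun_apply)
    (auto intro: bounded_linear_compose[OF bounded_linear_scale] blinfun.bounded_linear_right)

text \<open>Functions on \<open>U\<close> are represented by total functions; only their values on \<open>U\<close> matter.\<close>

definition slope_function ::
  "('k::real_or_complex \<Rightarrow> 'e::banach \<Rightarrow> 'e) \<Rightarrow> ('k \<Rightarrow> 'f::banach \<Rightarrow> 'f) \<Rightarrow> 'e set \<Rightarrow>
    ('e \<Rightarrow> 'f) \<Rightarrow> 'e \<Rightarrow> ('e \<Rightarrow> 'e \<Rightarrow>\<^sub>L 'f) \<Rightarrow> bool"
  where "slope_function sE sF U f x \<Phi> \<longleftrightarrow>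
    \<Phi> \<in> U \<rightarrow> bounded_operators sE sF \<and>
    continuous (at x within U) \<Phi> \<and>
    (\<forall>y\<in>U. f y = f x + blinfun_apply (\<Phi> y) (y - x))"

definition caratheodory_differentiable ::
  "('k::real_or_complex \<Rightarrow> 'e::banach \<Rightarrow> 'e) \<Rightarrow> ('k \<Rightarrow> 'f::banach \<Rightarrow> 'f) \<Rightarrow> 'e set \<Rightarrow>
    ('e \<Rightarrow> 'f) \<Rightarrow> 'e \<Rightarrow> bool"
  where "caratheodory_differentiable sE sF U f x \<longleftrightarrow> (\<exists>\<Phi>. slope_function sE sF U f x \<Phi>)"

definition caratheodory_derivative ::
  "('k::real_or_complex \<Rightarrow> 'e::banach \<Rightarrow> 'e) \<Rightarrow> ('k \<Rightarrow> 'f::banach \<Rightarrow> 'f) \<Rightarrow> 'e set \<Rightarrow>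
    ('e \<Rightarrow> 'f) \<Rightarrow> 'e \<Rightarrow> ('e \<Rightarrow>\<^sub>L 'f)"
  where "caratheodory_derivative sE sF U f x =
    (THE A. \<exists>\<Phi>. slope_function sE sF U f x \<Phi> \<and> A = \<Phi> x)"

lemma slope_function_has_derivative:
  assumes "slope_function sE sF U f x \<Phi>" and "open U" and "x \<in> U"
  shows "(f has_derivative blinfun_apply (\<Phi> x)) (at x)"
proof -
  have cont: "(\<Phi> \<longlongrightarrow> \<Phi> x) (at x)"
    using assms unfolding slope_function_def continuous_within
    by (metis at_within_open)
  then have lim: "((\<lambda>y. norm (\<Phi> y - \<Phi> x)) \<longlongrightarrow> 0) (at x)"
    by (intro tendsto_norm_zero LIM_zero)
  have "\<forall>\<^sub>F y in at x. y \<in> U"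
    using assms(2,3) by (rule eventually_at_in_open')
  then have "\<forall>\<^sub>F y in at x.
      norm (norm (f y - f x - blinfun_apply (\<Phi> x) (y - x)) / norm (y - x)) \<le> norm (\<Phi> y - \<Phi> x)"
  proof eventually_elim
    case (elim y)
    then have "f y - f x - blinfun_apply (\<Phi> x) (y - x) = blinfun_apply (\<Phi> y - \<Phi> x) (y - x)"
      using assms(1) unfolding slope_function_def blinfun.diff_left
      by (metis add_diff_cancel_left')
    then have "norm (f y - f x - blinfun_apply (\<Phi> x) (y - x)) \<le> norm (\<Phi> y - \<Phi> x) * norm (y - x)"
      by (simp only: norm_blinfun)
    then show ?case
      by (cases "y = x") (simp_all add: pos_divide_le_eq)
  qed
  then have "((\<lambda>y. norm (f y - f x - blinfun_apply (\<Phi> x) (y - x)) / norm (y - x)) \<longlongrightarrow> 0) (at x)"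
    by (rule Lim_null_comparison) (rule lim)
  then show ?thesis
    by (simp add: has_derivative_iff_norm blinfun.bounded_linear_right)
qed

lemma caratheodory_derivative_eq:
  assumes "slope_function sE sF U f x \<Phi>" and "open U" and "x \<in> U"
  shows "caratheodory_derivative sE sF U f x = \<Phi> x"
  unfolding caratheodory_derivative_def
proof (rule the_equality)
  show "\<exists>\<Psi>. slope_function sE sF U f x \<Psi> \<and> \<Phi> x = \<Psi> x"
    using assms by blast
  show "A = \<Phi> x" if "\<exists>\<Psi>. slope_function sE sF U f x \<Psi> \<and> A = \<Psi> x" for A
    using that has_derivative_unique[OF slope_function_has_derivative[OF _ assms(2,3)]
        slope_function_has_derivative[OF assms]]
    by (auto simp: blinfun_apply_inject)
qed

end

theory Submission
  imports Defs
begin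

text \<open>Slope functions can be combined pointwise: if \<open>\<Phi>\<close> and \<open>\<Psi>\<close> are slope functions of \<open>f\<close> and
  \<open>g\<close> at \<open>x\<close>, then \<open>l \<Phi> + m \<Psi>\<close> is one of \<open>l f + m g\<close>. The slope equation for the combination is
  the combination of the two slope equations, and continuity at \<open>x\<close> is inherited because addition
  and scalar multiplication on \<open>\<L>(E,F)\<close> are continuous in the operator norm. Evaluating the
  combined slope function at \<open>x\<close> gives the derivative, since the derivative can be read off from
  any slope function (\<open>caratheodory_derivative_eq\<close>).\<close>

text \<open>The bound \<open>norm c\<close> on the operator norm is what makes \<open>y \<mapsto> c \<Phi>(y)\<close> continuous at \<open>x\<close>
  for a slope function \<open>\<Phi>\<close>.\<close>

lemma (in banach_space_over) bounded_linear_scale_operator: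
  "bounded_linear (scale_operator scale c :: ('a::banach \<Rightarrow>\<^sub>L 'e) \<Rightarrow> _)"
proof (rule bounded_linear_intro[where K = "norm c"])
  fix A B :: "'a \<Rightarrow>\<^sub>L 'e" and r :: real
  show "scale_operator scale c (A + B) = scale_operator scale c A + scale_operator scale c B"
    by (rule blinfun_eqI) (simp add: scale_operator_apply blinfun.add_left scale_right_distrib)
  show "scale_operator scale c (r *\<^sub>R A) = r *\<^sub>R scale_operator scale c A"
    by (rule blinfun_eqI)
      (simp add: scale_operator_apply blinfun.scaleR_left mult.commute flip: scale_of_real)
  show "norm (scale_operator scale c A) \<le> norm A * norm c"
  proof (rule norm_blinfun_bound)
    fix h
    have "norm c * norm (blinfun_apply A h) \<le> norm c * (norm A * norm h)"
      by (intro mult_left_mono norm_blinfun norm_ge_zero)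
    then show "norm (blinfun_apply (scale_operator scale c A) h) \<le> norm A * norm c * norm h"
      by (simp add: scale_operator_apply norm_scale ac_simps)
  qed simp
qed

text \<open>Slope functions must take values in \<open>\<L>(E,F)\<close>, and not merely in the bounded real-linear
  maps. Linearity over \<open>'k\<close> survives multiplication by a scalar because \<open>'k\<close> is commutative.\<close>

lemma bounded_operators_linear_combination:
  assumes "banach_space_over sE" and "banach_space_over sF"
    and "A \<in> bounded_operators sE sF" and "B \<in> bounded_operators sE sF"
  shows "scale_operator sF l A + scale_operator sF m B \<in> bounded_operators sE sF"
proof -
  interpret E: banach_space_over sE by fact
  interpret F: banach_space_over sF by fact
  interpret vector_space_pair sE sF ..
  have "blinfun_apply (scale_operator sF l A + scale_operator sF m B) =
      (\<lambda>h. sF l (blinfun_apply A h) + sF m (blinfun_apply B h))"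
    by (rule ext) (simp add: blinfun.add_left F.scale_operator_apply)
  then show ?thesis
    using assms(3,4) unfolding bounded_operators_def
    by (simp add: linear_compose_add linear_compose_scale_right)
qed

lemma slope_function_linear_combination:
  assumes "banach_space_over sE" and "banach_space_over sF"
    and f: "slope_function sE sF U f x \<Phi>" and g: "slope_function sE sF U g x \<Psi>"
  shows "slope_function sE sF U (\<lambda>y. sF l (f y) + sF m (g y)) x
    (\<lambda>y. scale_operator sF l (\<Phi> y) + scale_operator sF m (\<Psi> y))" (is "slope_function _ _ _ ?h _ ?\<Theta>")
  unfolding slope_function_def
proof (intro conjI ballI)
  interpret F: banach_space_over sF by fact
  show "?\<Theta> \<in> U \<rightarrow> bounded_operators sE sF"
    using f g bounded_operators_linear_combination[OF assms(1,2)]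
    unfolding slope_function_def by blast
  show "continuous (at x within U) ?\<Theta>"
    using f g unfolding slope_function_def
    by (intro continuous_add bounded_linear.continuous[OF F.bounded_linear_scale_operator]) auto
  fix y assume "y \<in> U"
  then have fy: "f y = f x + blinfun_apply (\<Phi> y) (y - x)"
    and gy: "g y = g x + blinfun_apply (\<Psi> y) (y - x)"
    using f g unfolding slope_function_def by blast+
  show "?h y = ?h x + blinfun_apply (?\<Theta> y) (y - x)"
    unfolding fy gy
    by (simp add: blinfun.add_left F.scale_operator_apply F.scale_right_distrib)
qed

theorem proposition3p1:
  fixes sE :: "'k::real_or_complex \<Rightarrow> 'e::banach \<Rightarrow> 'e"
    and sF :: "'k \<Rightarrow> 'f::banach \<Rightarrow> 'f"
    and U :: "'e set" and f g :: "'e \<Rightarrow> 'f" and x :: 'e and l m :: 'k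
  assumes "banach_space_over sE" and "banach_space_over sF"
    and "open U" and "x \<in> U"
    and "caratheodory_differentiable sE sF U f x"
    and "caratheodory_differentiable sE sF U g x"
  shows "caratheodory_differentiable sE sF U (\<lambda>y. sF l (f y) + sF m (g y)) x \<and>
    caratheodory_derivative sE sF U (\<lambda>y. sF l (f y) + sF m (g y)) x =
      scale_operator sF l (caratheodory_derivative sE sF U f x) +
      scale_operator sF m (caratheodory_derivative sE sF U g x)"
proof -
  obtain \<Phi> \<Psi> where f: "slope_function sE sF U f x \<Phi>" and g: "slope_function sE sF U g x \<Psi>"
    using assms(5,6) unfolding caratheodory_differentiable_def by blast
  note h = slope_function_linear_combination[OF assms(1,2) f g, of l m]
  show ?thesis
    using h caratheodory_derivative_eq[OF h assms(3,4)]
      caratheodory_derivative_eq[OF f assms(3,4)] caratheodory_derivative_eq[OF g assms(3,4)]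
    unfolding caratheodory_differentiable_def by auto
qed

end
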